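(* Let $(X,\Sigma,m)$ be a $\sigma$-finite measure space, let $\mathcal P:L_1(X)\to L_1(X)$ be a Markov operator, and let $\mathcal A\subset\Sigma$ be an admissible family. If there exists a positive measurable function $u:X\to\mathbb R$ that is properly subinvariant (for $\mathcal P$) and locally integrable with respect to $\mathcal A$, then $\mathcal P$ is sweeping with respect to $\mathcal A$.
   Context: All equalities and inequalities between functions and between sets are understood up to sets of $m$-measure zero. $L_1(X)$ denotes the space of (real-valued) measurable functions $f$ with $\|f\|=\int_X|f|\,dm<\infty$, functions differing only on a null set being identified. Markov operator: a linear operator $\mathcal P:L_1(X)\to L_1(X)$ that is a contraction ($\|\mathcal Pf\|\le\|f\|$ for all $f\in L_1(X)$) and positive ($f\ge 0\Rightarrow \mathcal Pf\ge 0$). Extension: $\mathcal P$ is extended to all non-negative measurable functions $f$ by $(\mathcal Pf)(x)=\lim_{k\to\infty}(\mathcal Pf_k)(x)$, where $\{f_k\}\subset L_1(X)$ is any sequence of non-negative functions converging monotonically (increasingly) to $f$ pointwise almost everywhere; the value $+\infty$ is allowed, and the result does not depend on the chosen sequence. Properly subinvariant: $u$ satisfies $\mathcal Pu<u$ (almost everywhere). Admissible family: $\mathcal A\subset\Sigma$ such that (i) $m(A)<\infty$ for all $A\in\mathcal A$; (ii) $A_1,A_2\in\mathcal A$ implies $A_1\cup A_2\in\mathcal A$; (iii) there is a countable subfamily $\{A_n\}\subset\mathcal A$ with $\bigcup_nA_n=X$ (up to a null set). Locally integrable with respect to $\mathcal A$ (for a non-negative measurable $u$): $\int_A u\,dm<\infty$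 for all $A\in\mathcal A$. Sweeping with respect to $\mathcal A$: $\lim_{n\to\infty}\int_A \mathcal P^nf\,dm=0$ for all $A\in\mathcal A$ and all $f\in L_1(X)$. *)

theory Defs
  imports "HOL-Analysis.Analysis"
begin

text \<open>
  The space \<open>L\<^sub>1(X)\<close> is represented by the integrable functions \<open>'a \<Rightarrow> real\<close>, with equality almost
  everywhere as equality. An operator on \<open>L\<^sub>1(X)\<close> is a map \<open>P\<close> on functions which sends integrable
  functions to integrable ones and respects equality almost everywhere; its values on functions
  that are not integrable are irrelevant.
\<close>

definition L1_operator :: "'a measure \<Rightarrow> (('a \<Rightarrow> real) \<Rightarrow> 'a \<Rightarrow> real) \<Rightarrow> bool" where
  "L1_operator M P \<longleftrightarrow>
     (\<forall>f. integrable M f \<longrightarrow> integrable M (P f)) \<and>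
     (\<forall>f g. integrable M f \<longrightarrow> integrable M g \<longrightarrow>
        (AE x in M. f x = g x) \<longrightarrow> (AE x in M. P f x = P g x))"

definition markov_operator :: "'a measure \<Rightarrow> (('a \<Rightarrow> real) \<Rightarrow> 'a \<Rightarrow> real) \<Rightarrow> bool" where
  "markov_operator M P \<longleftrightarrow>
     L1_operator M P \<and>
     (\<forall>f g. integrable M f \<longrightarrow> integrable M g \<longrightarrow>
        (AE x in M. P (\<lambda>y. f y + g y) x = P f x + P g x)) \<and>
     (\<forall>c f. integrable M f \<longrightarrow> (AE x in M. P (\<lambda>y. c * f y) x = c * P f x)) \<and>
     (\<forall>f. integrable M f \<longrightarrow> (LINT x|M. \<bar>P f x\<bar>) \<le> (LINT x|M. \<bar>f x\<bar>)) \<and>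
     (\<forall>f. integrable M f \<longrightarrow> (AE x in M. 0 \<le> f x) \<longrightarrow> (AE x in M. 0 \<le> P f x))"

definition L1_approximation :: "'a measure \<Rightarrow> (nat \<Rightarrow> 'a \<Rightarrow> real) \<Rightarrow> ('a \<Rightarrow> ennreal) \<Rightarrow> bool" where
  "L1_approximation M F f \<longleftrightarrow>
     (\<forall>k. integrable M (F k)) \<and> (\<forall>k. AE x in M. 0 \<le> F k x) \<and>
     (AE x in M. incseq (\<lambda>k. F k x) \<and> (\<lambda>k. ennreal (F k x)) \<longlonglongrightarrow> f x)"

text \<open>
  The extension of \<open>P\<close> to non-negative measurable functions is defined through an arbitrarily chosen
  approximating sequence. On a \<open>\<sigma>\<close>-finite space such a sequence exists
  (\<open>L1_approximation_exists\<close>), and up to a null set the result does not depend on the choice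
  (\<open>markov_extension_eq\<close>).
\<close>

definition markov_extension ::
    "'a measure \<Rightarrow> (('a \<Rightarrow> real) \<Rightarrow> 'a \<Rightarrow> real) \<Rightarrow> ('a \<Rightarrow> ennreal) \<Rightarrow> 'a \<Rightarrow> ennreal" where
  "markov_extension M P f =
     (let F = (SOME F. L1_approximation M F f) in (\<lambda>x. lim (\<lambda>k. ennreal (P (F k) x))))"

definition properly_subinvariant ::
    "'a measure \<Rightarrow> (('a \<Rightarrow> real) \<Rightarrow> 'a \<Rightarrow> real) \<Rightarrow> ('a \<Rightarrow> ennreal) \<Rightarrow> bool" where
  "properly_subinvariant M P u \<longleftrightarrow> (AE x in M. markov_extension M P u x < u x)"

definition admissible_family :: "'a measure \<Rightarrow> 'a set set \<Rightarrow> bool" where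
  "admissible_family M \<A> \<longleftrightarrow>
     \<A> \<subseteq> sets M \<and>
     (\<forall>A\<in>\<A>. emeasure M A < \<infinity>) \<and>
     (\<forall>A\<in>\<A>. \<forall>B\<in>\<A>. A \<union> B \<in> \<A>) \<and>
     (\<exists>\<C>. \<C> \<subseteq> \<A> \<and> countable \<C> \<and> (AE x in M. x \<in> \<Union>\<C>))"

definition locally_integrable :: "'a measure \<Rightarrow> 'a set set \<Rightarrow> ('a \<Rightarrow> ennreal) \<Rightarrow> bool" where
  "locally_integrable M \<A> u \<longleftrightarrow> (\<forall>A\<in>\<A>. (\<integral>\<^sup>+x\<in>A. u x \<partial>M) < \<infinity>)"

definition sweeping :: "'a measure \<Rightarrow> 'a set set \<Rightarrow> (('a \<Rightarrow> real) \<Rightarrow> 'a \<Rightarrow> real) \<Rightarrow> bool" where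
  "sweeping M \<A> P \<longleftrightarrow>
     (\<forall>A\<in>\<A>. \<forall>f. integrable M f \<longrightarrow> (\<lambda>n. LINT x:A|M. (P ^^ n) f x) \<longlonglongrightarrow> 0)"

lemma L1_approximation_exists:
  assumes "sigma_finite_measure M" and [measurable]: "f \<in> borel_measurable M"
  shows "\<exists>F. L1_approximation M F f"
proof -
  obtain A :: "nat \<Rightarrow> 'a set" where A: "range A \<subseteq> sets M" "(\<Union>i. A i) = space M"
      "\<And>i. emeasure M (A i) \<noteq> \<infinity>" "incseq A"
    using sigma_finite_measure.sigma_finite_incseq[OF assms(1)] by metis
  have [measurable]: "A k \<in> sets M" for k using A(1) by auto
  define F where "F k x = enn2real (min (f x) (of_nat k)) * indicator (A k) x" for k x
  have [measurable]: "F k \<in> borel_measurable M" for k unfolding F_def by measurable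
  have fin: "min (f x) (of_nat k) < top" for x k
    by (simp add: min_less_iff_disj of_nat_less_top)
  have F_le: "\<bar>F k x\<bar> \<le> real k * indicator (A k) x" for k x
  proof -
    have "enn2real (min (f x) (of_nat k)) \<le> enn2real (of_nat k)"
      by (intro enn2real_mono) (auto simp: of_nat_less_top)
    then show ?thesis by (auto simp: F_def indicator_def)
  qed
  have int: "integrable M (F k)" for k
  proof (rule Bochner_Integration.integrable_bound)
    show "integrable M (\<lambda>x. real k * indicator (A k) x)"
      using A(3)[of k] by (intro integrable_mult_right integrable_real_indicator) (auto simp: top.not_eq_extremum)
    show "AE x in M. norm (F k x) \<le> norm (real k * indicator (A k) x :: real)"
      using F_le by (intro AE_I2) (simp add: indicator_def)
  qed simp
  have inc: "incseq (\<lambda>k. F k x)" for x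
  proof (rule incseq_SucI)
    fix k
    have "min (f x) (of_nat k) \<le> min (f x) (of_nat (Suc k))"
      by (intro min.mono order_refl of_nat_mono) auto
    then have "enn2real (min (f x) (of_nat k)) \<le> enn2real (min (f x) (of_nat (Suc k)))"
      by (rule enn2real_mono[OF _ fin])
    moreover have "indicator (A k) x \<le> (indicator (A (Suc k)) x :: real)"
      using A(4) by (auto simp: indicator_def incseq_Suc_iff)
    ultimately show "F k x \<le> F (Suc k) x"
      unfolding F_def by (intro mult_mono) auto
  qed
  have lim: "(\<lambda>k. ennreal (F k x)) \<longlonglongrightarrow> f x" if x: "x \<in> space M" for x
  proof -
    obtain i where i: "x \<in> A i" using A(2) x by auto
    have "(\<lambda>k. min (f x) (of_nat k)) \<longlonglongrightarrow> min (f x) top"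
      by (intro tendsto_min tendsto_const of_nat_tendsto_top_ennreal)
    moreover have "\<forall>\<^sub>F k in sequentially. min (f x) (of_nat k) = ennreal (F k x)"
      using eventually_ge_at_top[of i]
    proof eventually_elim
      case (elim k)
      then have "x \<in> A k" using i A(4) by (auto dest: incseqD)
      then show ?case using fin[of x k] by (simp add: F_def)
    qed
    ultimately show ?thesis by (auto dest: Lim_transform_eventually)
  qed
  show ?thesis unfolding L1_approximation_def
    using int inc lim by (intro exI[of _ F] conjI allI AE_I2) (auto simp: F_def)
qed

context
  fixes M :: "'a measure" and P :: "('a \<Rightarrow> real) \<Rightarrow> 'a \<Rightarrow> real"
  assumes P: "markov_operator M P"
begin

lemma markov_integrable: "integrable M f \<Longrightarrow> integrable M (P f)"
  using P by (simp add: markov_operator_def L1_operator_def)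

lemma markov_contraction: "integrable M f \<Longrightarrow> (LINT x|M. \<bar>P f x\<bar>) \<le> (LINT x|M. \<bar>f x\<bar>)"
  using P by (simp add: markov_operator_def)

lemma markov_diff:
  assumes f: "integrable M f" and g: "integrable M g"
  shows "AE x in M. P (\<lambda>y. f y - g y) x = P f x - P g x"
proof -
  have "AE x in M. P (\<lambda>y. f y + (- 1) * g y) x = P f x + P (\<lambda>y. (- 1) * g y) x"
    using P f integrable_mult_right[OF g, of "- 1"] unfolding markov_operator_def by blast
  moreover have "AE x in M. P (\<lambda>y. (- 1) * g y) x = (- 1) * P g x"
    using P g unfolding markov_operator_def by blast
  ultimately show ?thesis by eventually_elim simp
qed

lemma markov_mono:
  assumes f: "integrable M f" and g: "integrable M g" and le: "AE x in M. f x \<le> g x"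
  shows "AE x in M. P f x \<le> P g x"
proof -
  have "AE x in M. 0 \<le> g x - f x" using le by eventually_elim simp
  then have "AE x in M. 0 \<le> P (\<lambda>y. g y - f y) x"
    using P Bochner_Integration.integrable_diff[OF g f] unfolding markov_operator_def by blast
  with markov_diff[OF g f] show ?thesis by eventually_elim simp
qed

lemma L1_approximation_le:
  assumes F: "L1_approximation M F f" and G: "L1_approximation M G f"
  shows "AE x in M. ennreal (P (F k) x) \<le> (SUP j. ennreal (P (G j) x))"
proof -
  have intF: "integrable M (F i)" and intG: "integrable M (G i)" for i
    using F G by (auto simp: L1_approximation_def)
  define H where "H j x = min (F k x) (G j x)" for j x
  have intH: "integrable M (H j)" for j
    unfolding H_def using intF intG by (intro integrable_min)
  have intD: "integrable M (\<lambda>x. F k x - H j x)" for j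
    using intF intH by (rule Bochner_Integration.integrable_diff)
  have Gnn: "AE x in M. \<forall>j. 0 \<le> G j x" and Fnn: "AE x in M. \<forall>j. 0 \<le> F j x"
    using F G by (auto simp: L1_approximation_def AE_all_countable)
  have Glim: "AE x in M. (\<lambda>j. ennreal (G j x)) \<longlonglongrightarrow> f x"
    using G by (auto simp: L1_approximation_def)
  have Fle: "AE x in M. ennreal (F k x) \<le> f x"
  proof -
    have "AE x in M. incseq (\<lambda>k. F k x) \<and> (\<lambda>k. ennreal (F k x)) \<longlonglongrightarrow> f x"
      using F by (auto simp: L1_approximation_def)
    then show ?thesis
    proof eventually_elim
      case (elim x)
      then have "incseq (\<lambda>k. ennreal (F k x))"
        by (auto simp: incseq_def intro: ennreal_leI)
      then show ?case using elim by (auto intro: incseq_le)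
    qed
  qed
  have lim0: "(\<lambda>j. LINT x|M. \<bar>F k x - H j x\<bar>) \<longlonglongrightarrow> (LINT x|M. (0::real))"
  proof (rule integral_dominated_convergence)
    show "integrable M (\<lambda>x. \<bar>F k x\<bar>)" using intF by (rule integrable_abs)
    show "(\<lambda>x. \<bar>F k x - H j x\<bar>) \<in> borel_measurable M" for j
      using intD by (intro borel_measurable_integrable integrable_abs)
    show "AE x in M. norm \<bar>F k x - H j x\<bar> \<le> \<bar>F k x\<bar>" for j
      using Gnn Fnn
    proof eventually_elim
      case (elim x)
      then have "0 \<le> F k x" "0 \<le> G j x" by auto
      then show ?case by (auto simp: H_def min_def)
    qed
    show "AE x in M. (\<lambda>j. \<bar>F k x - H j x\<bar>) \<longlonglongrightarrow> 0"
      using Gnn Fnn Glim Fle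
    proof eventually_elim
      case (elim x)
      have "(\<lambda>j. min (ennreal (F k x)) (ennreal (G j x))) \<longlonglongrightarrow> min (ennreal (F k x)) (f x)"
        using elim by (intro tendsto_min tendsto_const)
      moreover have "min (ennreal (F k x)) (ennreal (G j x)) = ennreal (H j x)" for j
        using elim by (auto simp: H_def min_def ennreal_le_iff)
      ultimately have "(\<lambda>j. ennreal (H j x)) \<longlonglongrightarrow> ennreal (F k x)"
        using elim by (simp add: min_absorb1)
      then have "(\<lambda>j. H j x) \<longlonglongrightarrow> F k x"
        using elim by (subst (asm) tendsto_ennreal_iff) (auto simp: H_def)
      then have "(\<lambda>j. \<bar>F k x - H j x\<bar>) \<longlonglongrightarrow> \<bar>F k x - F k x\<bar>"
        by (intro tendsto_intros)
      then show ?case by simp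
    qed
  qed simp
  define s where "s x = (SUP j. ennreal (P (G j) x))" for x
  have [measurable]: "P (F k) \<in> borel_measurable M" "\<And>j. P (G j) \<in> borel_measurable M"
    using markov_integrable intF intG by auto
  have [measurable]: "s \<in> borel_measurable M" unfolding s_def by measurable
  define I where "I = (\<integral>\<^sup>+x. (ennreal (P (F k) x) - s x) \<partial>M)"
  have I_le: "I \<le> ennreal (LINT x|M. \<bar>F k x - H j x\<bar>)" for j
  proof -
    have "AE x in M. P (H j) x \<le> P (G j) x"
      using intH intG by (intro markov_mono) (auto simp: H_def)
    with markov_diff[OF intF intH, of k j]
    have "AE x in M. ennreal (P (F k) x) - s x \<le> ennreal \<bar>P (\<lambda>y. F k y - H j y) x\<bar>"
    proof eventually_elim
      case (elim x)
      have "P (F k) x \<le> P (G j) x + \<bar>P (\<lambda>y. F k y - H j y) x\<bar>" using elim by linarith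
      then have "ennreal (P (F k) x) \<le> ennreal (max 0 (P (G j) x) + \<bar>P (\<lambda>y. F k y - H j y) x\<bar>)"
        by (intro ennreal_leI) linarith
      also have "\<dots> = ennreal (P (G j) x) + ennreal \<bar>P (\<lambda>y. F k y - H j y) x\<bar>"
        by (subst ennreal_plus) (auto simp: max_def ennreal_neg)
      also have "\<dots> \<le> s x + ennreal \<bar>P (\<lambda>y. F k y - H j y) x\<bar>"
        unfolding s_def by (intro add_right_mono SUP_upper) auto
      finally show ?case by (auto simp: ennreal_minus_le_iff)
    qed
    then have "I \<le> (\<integral>\<^sup>+x. ennreal \<bar>P (\<lambda>y. F k y - H j y) x\<bar> \<partial>M)"
      unfolding I_def by (rule nn_integral_mono_AE)
    also have "\<dots> = ennreal (LINT x|M. \<bar>P (\<lambda>y. F k y - H j y) x\<bar>)"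
      using markov_integrable[OF intD] by (intro nn_integral_eq_integral integrable_abs) auto
    also have "\<dots> \<le> ennreal (LINT x|M. \<bar>F k x - H j x\<bar>)"
      by (intro ennreal_leI markov_contraction intD)
    finally show ?thesis .
  qed
  have "(\<lambda>j. ennreal (LINT x|M. \<bar>F k x - H j x\<bar>)) \<longlonglongrightarrow> ennreal 0"
    using lim0 by (intro tendsto_ennrealI) simp
  then have "I \<le> ennreal 0"
    using I_le by (intro LIMSEQ_le_const) auto
  then have "I = 0" by simp
  then have "AE x in M. ennreal (P (F k) x) - s x = 0"
    unfolding I_def by (subst (asm) nn_integral_0_iff_AE) auto
  then show ?thesis unfolding s_def[symmetric]
    by eventually_elim (auto simp: diff_eq_0_iff_ennreal)
qed

lemma L1_approximation_tendsto_SUP: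
  assumes F: "L1_approximation M F f"
  shows "AE x in M. (\<lambda>k. ennreal (P (F k) x)) \<longlonglongrightarrow> (SUP k. ennreal (P (F k) x))"
proof -
  have int: "integrable M (F i)" for i using F by (auto simp: L1_approximation_def)
  have "AE x in M. P (F k) x \<le> P (F (Suc k)) x" for k
  proof (rule markov_mono[OF int int])
    have "AE x in M. incseq (\<lambda>k. F k x)" using F by (auto simp: L1_approximation_def)
    then show "AE x in M. F k x \<le> F (Suc k) x" by eventually_elim (auto simp: incseq_Suc_iff)
  qed
  then have "AE x in M. \<forall>k. P (F k) x \<le> P (F (Suc k)) x" by (simp add: AE_all_countable)
  then show ?thesis
    by eventually_elim (auto intro!: LIMSEQ_SUP incseq_SucI ennreal_leI)
qed

theorem markov_extension_eq:
  assumes F: "L1_approximation M F f"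
  shows "AE x in M. (\<lambda>k. ennreal (P (F k) x)) \<longlonglongrightarrow> markov_extension M P f x"
proof -
  define G where "G = (SOME F. L1_approximation M F f)"
  have G: "L1_approximation M G f" unfolding G_def by (rule someI[where P = "\<lambda>F. L1_approximation M F f", OF F])
  have "AE x in M. \<forall>k. ennreal (P (F k) x) \<le> (SUP j. ennreal (P (G j) x))"
    using L1_approximation_le[OF F G] by (simp add: AE_all_countable)
  moreover have "AE x in M. \<forall>k. ennreal (P (G k) x) \<le> (SUP j. ennreal (P (F j) x))"
    using L1_approximation_le[OF G F] by (simp add: AE_all_countable)
  ultimately show ?thesis
    using L1_approximation_tendsto_SUP[OF F] L1_approximation_tendsto_SUP[OF G]
  proof eventually_elim
    case (elim x)
    have "(SUP k. ennreal (P (F k) x)) = (SUP k. ennreal (P (G k) x))"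
      using elim(1,2) by (intro antisym SUP_least) auto
    moreover have "markov_extension M P f x = (SUP k. ennreal (P (G k) x))"
      using limI[OF elim(4)] by (simp add: markov_extension_def G_def Let_def)
    ultimately show ?case using elim(3) by simp
  qed
qed

end

end

theory Submission
  imports Defs
begin

text \<open>
  Let \<open>v\<close> be the decreasing limit of \<open>P\<^sup>n u\<close>. As \<open>P u\<close> is finite almost everywhere, the continuity
  of \<open>P\<close> along increasing sequences, applied to \<open>u - P\<^sup>n u\<close>, gives \<open>v \<le> P v\<close>. Proper subinvariance
  makes \<open>w = u - v\<close> strictly positive, and \<open>P\<^sup>n w \<le> P\<^sup>n u - v\<close> decreases to \<open>0\<close>. Hence
  \<open>\<integral>\<^sub>A P\<^sup>n w \<longlonglongrightarrow> 0\<close> by dominated convergence with the bound \<open>u\<close>. As \<open>w > 0\<close>, the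
  functions bounded by a multiple of \<open>w\<close> are dense in \<open>L\<^sub>1\<close>, and contractivity of \<open>P\<^sup>n\<close> concludes.
\<close>

section \<open>Iterates of a Markov operator\<close>

lemma markov_cong:
  assumes P: "markov_operator M P" and "integrable M f" "integrable M g" "AE x in M. f x = g x"
  shows "AE x in M. P f x = P g x"
proof -
  have "\<forall>f g. integrable M f \<longrightarrow> integrable M g \<longrightarrow>
      (AE x in M. f x = g x) \<longrightarrow> (AE x in M. P f x = P g x)"
    using P unfolding markov_operator_def L1_operator_def by (elim conjE)
  from this[rule_format, OF assms(2-4)] show ?thesis .
qed

lemma markov_add:
  assumes P: "markov_operator M P" and f: "integrable M f" and g: "integrable M g"
  shows "AE x in M. P (\<lambda>y. f y + g y) x = P f x + P g x"
proof -
  have "\<forall>f g. integrable M f \<longrightarrow> integrable M g \<longrightarrow>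
      (AE x in M. P (\<lambda>y. f y + g y) x = P f x + P g x)"
    using P unfolding markov_operator_def by (elim conjE)
  from this[rule_format, OF f g] show ?thesis .
qed

lemma markov_mult:
  assumes P: "markov_operator M P" and f: "integrable M f"
  shows "AE x in M. P (\<lambda>y. c * f y) x = c * P f x"
proof -
  have "\<forall>c f. integrable M f \<longrightarrow> (AE x in M. P (\<lambda>y. c * f y) x = c * P f x)"
    using P unfolding markov_operator_def by (elim conjE)
  from this[rule_format, OF f] show ?thesis .
qed

lemma markov_nonneg:
  assumes P: "markov_operator M P" and f: "integrable M f" and nn: "AE x in M. 0 \<le> f x"
  shows "AE x in M. 0 \<le> P f x"
proof -
  have "\<forall>f. integrable M f \<longrightarrow> (AE x in M. 0 \<le> f x) \<longrightarrow> (AE x in M. 0 \<le> P f x)"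
    using P unfolding markov_operator_def by (elim conjE)
  from this[rule_format, OF f nn] show ?thesis .
qed

lemma markov_operator_comp:
  assumes P: "markov_operator M P" and Q: "markov_operator M Q"
  shows "markov_operator M (P \<circ> Q)"
proof -
  note int = markov_integrable[OF P] markov_integrable[OF Q]
  have "AE x in M. P (Q f) x = P (Q g) x"
    if "integrable M f" "integrable M g" "AE x in M. f x = g x" for f g
    using that by (intro markov_cong[OF P] markov_cong[OF Q] int)
  moreover have "AE x in M. P (Q (\<lambda>y. f y + g y)) x = P (Q f) x + P (Q g) x"
    if f: "integrable M f" and g: "integrable M g" for f g
  proof -
    \<comment> \<open>The identity for \<open>Q\<close> holds only almost everywhere, so it passes
      under \<open>P\<close> through \<open>markov_cong\<close> and not by rewriting.\<close>
    have "AE x in M. P (Q (\<lambda>y. f y + g y)) x = P (\<lambda>y. Q f y + Q g y) x"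
      using f g by (intro markov_cong[OF P] markov_add[OF Q] int Bochner_Integration.integrable_add)
    moreover have "AE x in M. P (\<lambda>y. Q f y + Q g y) x = P (Q f) x + P (Q g) x"
      using f g by (intro markov_add[OF P] int)
    ultimately show ?thesis by eventually_elim simp
  qed
  moreover have "AE x in M. P (Q (\<lambda>y. c * f y)) x = c * P (Q f) x"
    if f: "integrable M f" for c f
  proof -
    have "AE x in M. P (Q (\<lambda>y. c * f y)) x = P (\<lambda>y. c * Q f y) x"
      using f by (intro markov_cong[OF P] markov_mult[OF Q] int integrable_mult_right)
    moreover have "AE x in M. P (\<lambda>y. c * Q f y) x = c * P (Q f) x"
      using f by (intro markov_mult[OF P] int)
    ultimately show ?thesis by eventually_elim simp
  qed
  moreover have "(LINT x|M. \<bar>P (Q f) x\<bar>) \<le> (LINT x|M. \<bar>f x\<bar>)" if "integrable M f" for f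
    using markov_contraction[OF P int(2)[OF that]] markov_contraction[OF Q that] by linarith
  moreover have "AE x in M. 0 \<le> P (Q f) x" if "integrable M f" "AE x in M. 0 \<le> f x" for f
    using that by (intro markov_nonneg[OF P] markov_nonneg[OF Q] int)
  ultimately show ?thesis
    unfolding markov_operator_def L1_operator_def comp_apply
    by (intro conjI allI impI int)
qed

text \<open>Makes contraction, positivity and linearity available for \<open>P ^^ n\<close>
  directly, with bounds uniform in \<open>n\<close>.\<close>

lemma markov_operator_funpow:
  assumes P: "markov_operator M P"
  shows "markov_operator M (P ^^ n)"
proof (induction n)
  case 0
  show ?case unfolding markov_operator_def L1_operator_def funpow_0
    by (intro conjI allI impI) (assumption | (rule AE_I2, rule refl) | rule order_refl)+
next
  case (Suc n)
  show ?case unfolding funpow.simps by (rule markov_operator_comp[OF P Suc.IH])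
qed

text \<open>Monotonicity applied to both f \<le> |f| and -f \<le> |f|.\<close>

lemma markov_abs_le:
  assumes P: "markov_operator M P" and f: "integrable M f"
  shows "AE x in M. \<bar>P f x\<bar> \<le> P (\<lambda>y. \<bar>f y\<bar>) x"
proof -
  have "AE x in M. P f x \<le> P (\<lambda>y. \<bar>f y\<bar>) x"
    using f by (intro markov_mono[OF P]) auto
  moreover have "AE x in M. P (\<lambda>y. - 1 * f y) x \<le> P (\<lambda>y. \<bar>f y\<bar>) x"
    using f by (intro markov_mono[OF P] integrable_mult_right) auto
  moreover note markov_mult[OF P f, of "- 1"]
  ultimately show ?thesis by eventually_elim auto
qed

section \<open>The extension to non-negative functions\<close>

text \<open>
  \<^const>\<open>markov_extension\<close> takes a \<^const>\<open>lim\<close>, which is unspecified on the null set of divergence.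
  The supremum agrees with it almost everywhere and is measurable by construction.
\<close>

definition markov_sup ::
    "'a measure \<Rightarrow> (('a \<Rightarrow> real) \<Rightarrow> 'a \<Rightarrow> real) \<Rightarrow> ('a \<Rightarrow> ennreal) \<Rightarrow> 'a \<Rightarrow> ennreal" where
  "markov_sup M P f x = (SUP k. ennreal (P ((SOME F. L1_approximation M F f) k) x))"

section \<open>Operations on approximating sequences\<close>

lemma L1_approximation_SUP:
  assumes "L1_approximation M F f"
  shows "AE x in M. f x = (SUP k. ennreal (F k x))"
proof -
  have "AE x in M. incseq (\<lambda>k. F k x) \<and> (\<lambda>k. ennreal (F k x)) \<longlonglongrightarrow> f x"
    using assms by (auto simp: L1_approximation_def)
  then show ?thesis
  proof eventually_elim
    case (elim x)
    then have "incseq (\<lambda>k. ennreal (F k x))" by (auto simp: incseq_def intro: ennreal_leI)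
    then show ?case using elim LIMSEQ_SUP LIMSEQ_unique by blast
  qed
qed

text \<open>Serves the monotonicity of the extension. Independently chosen approximations need not
  satisfy \<open>F k\<close> \<le> \<open>G k\<close>; the pointwise maximum dominates
  \<open>F k\<close> and still tends to max f g = g.\<close>

lemma L1_approximation_max:
  assumes F: "L1_approximation M F f" and G: "L1_approximation M G g"
    and le: "AE x in M. f x \<le> g x"
  shows "L1_approximation M (\<lambda>k x. max (F k x) (G k x)) g"
proof -
  have "AE x in M. incseq (\<lambda>k. F k x) \<and> (\<lambda>k. ennreal (F k x)) \<longlonglongrightarrow> f x"
    and "AE x in M. incseq (\<lambda>k. G k x) \<and> (\<lambda>k. ennreal (G k x)) \<longlonglongrightarrow> g x"
    using F G by (auto simp: L1_approximation_def)
  then have "AE x in M. incseq (\<lambda>k. max (F k x) (G k x)) \<and>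
      (\<lambda>k. ennreal (max (F k x) (G k x))) \<longlonglongrightarrow> g x"
    using le
  proof eventually_elim
    case (elim x)
    have "(\<lambda>k. max (ennreal (F k x)) (ennreal (G k x))) \<longlonglongrightarrow> max (f x) (g x)"
      using elim by (intro tendsto_max) auto
    moreover have "max (ennreal a) (ennreal b) = ennreal (max a b)" for a b
      by (cases "a \<le> b") (simp_all add: max_absorb1 max_absorb2 ennreal_leI)
    moreover have "incseq (\<lambda>k. max (F k x) (G k x))"
      using elim unfolding incseq_def by (meson max.mono)
    ultimately show ?case using elim(3) by (simp add: max_absorb2)
  qed
  moreover have "AE x in M. 0 \<le> max (F k x) (G k x)" for k
  proof -
    have "AE x in M. 0 \<le> F k x" using F by (simp add: L1_approximation_def)
    then show ?thesis by eventually_elim auto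
  qed
  ultimately show ?thesis
    using F G by (simp add: L1_approximation_def)
qed

lemma L1_approximation_add:
  assumes F: "L1_approximation M F f" and G: "L1_approximation M G g"
  shows "L1_approximation M (\<lambda>k x. F k x + G k x) (\<lambda>x. f x + g x)"
proof -
  have nn: "AE x in M. \<forall>k. 0 \<le> F k x" "AE x in M. \<forall>k. 0 \<le> G k x"
    using F G by (auto simp: L1_approximation_def AE_all_countable)
  have "AE x in M. incseq (\<lambda>k. F k x) \<and> (\<lambda>k. ennreal (F k x)) \<longlonglongrightarrow> f x"
    and "AE x in M. incseq (\<lambda>k. G k x) \<and> (\<lambda>k. ennreal (G k x)) \<longlonglongrightarrow> g x"
    using F G by (auto simp: L1_approximation_def)
  with nn have "AE x in M. (\<forall>k. 0 \<le> F k x + G k x) \<and> incseq (\<lambda>k. F k x + G k x) \<and>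
      (\<lambda>k. ennreal (F k x + G k x)) \<longlonglongrightarrow> f x + g x"
  proof eventually_elim
    case (elim x)
    then have "(\<lambda>k. ennreal (F k x) + ennreal (G k x)) \<longlonglongrightarrow> f x + g x"
      by (intro tendsto_add) auto
    then show ?case using elim by (auto simp: incseq_def add_mono)
  qed
  then show ?thesis
    using F G by (auto simp: L1_approximation_def AE_all_countable)
qed

lemma L1_approximation_const:
  assumes "integrable M f" "AE x in M. 0 \<le> f x"
  shows "L1_approximation M (\<lambda>k. f) (\<lambda>x. ennreal (f x))"
  using assms by (auto simp: L1_approximation_def incseq_def)

text \<open>Cutting an increasing sequence, whose members may be infinite or non-integrable, off at
  \<open>f\<close> yields integrable functions that still increase to \<open>f\<close>.
  \<open>enn2real\<close> loses nothing, because the minimum is finite.\<close>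

lemma L1_approximation_min:
  fixes f :: "'a \<Rightarrow> real" and g :: "nat \<Rightarrow> 'a \<Rightarrow> ennreal"
  assumes f: "integrable M f" "AE x in M. 0 \<le> f x"
    and [measurable]: "\<And>n. g n \<in> borel_measurable M"
    and inc: "AE x in M. incseq (\<lambda>n. g n x)" and le: "AE x in M. ennreal (f x) \<le> (SUP n. g n x)"
  shows "L1_approximation M (\<lambda>n x. enn2real (min (ennreal (f x)) (g n x))) (\<lambda>x. ennreal (f x))"
proof -
  have [measurable]: "f \<in> borel_measurable M" using f by auto
  have fin: "min (ennreal a) b < top" for a and b :: ennreal
    by (simp add: min_less_iff_disj)
  have "integrable M (\<lambda>x. enn2real (min (ennreal (f x)) (g n x)))" for n
  proof (rule Bochner_Integration.integrable_bound[OF f(1)])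
    show "AE x in M. norm (enn2real (min (ennreal (f x)) (g n x))) \<le> norm (f x)"
      using f(2)
    proof eventually_elim
      case (elim x)
      have "enn2real (min (ennreal (f x)) (g n x)) \<le> enn2real (ennreal (f x))"
        by (intro enn2real_mono) auto
      then show ?case using elim by simp
    qed
  qed measurable
  moreover have "AE x in M. incseq (\<lambda>n. enn2real (min (ennreal (f x)) (g n x))) \<and>
      (\<lambda>n. ennreal (enn2real (min (ennreal (f x)) (g n x)))) \<longlonglongrightarrow> ennreal (f x)"
    using f(2) inc le
  proof eventually_elim
    case (elim x)
    have "incseq (\<lambda>n. enn2real (min (ennreal (f x)) (g n x)))"
      using elim(2) by (auto simp: incseq_def intro!: enn2real_mono min.mono fin)
    moreover have "(\<lambda>n. min (ennreal (f x)) (g n x)) \<longlonglongrightarrow> min (ennreal (f x)) (SUP n. g n x)"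
      using elim by (intro tendsto_min tendsto_const LIMSEQ_SUP)
    ultimately show ?case using elim(3) fin by (simp add: min_absorb1)
  qed
  ultimately show ?thesis by (simp add: L1_approximation_def)
qed

section \<open>Monotonicity, additivity and continuity of the extension\<close>

context
  fixes M :: "'a measure" and P :: "('a \<Rightarrow> real) \<Rightarrow> 'a \<Rightarrow> real"
  assumes M: "sigma_finite_measure M" and P: "markov_operator M P"
begin

text \<open>By \<open>L1_approximation_le\<close> in both directions, the images of two
  approximations of \<open>f\<close> have the same supremum.\<close>

lemma markov_sup_eq_SUP:
  assumes F: "L1_approximation M F f"
  shows "AE x in M. markov_sup M P f x = (SUP k. ennreal (P (F k) x))"
proof -
  define G where "G = (SOME F. L1_approximation M F f)"
  have G: "L1_approximation M G f"
    unfolding G_def by (rule someI[where P = "\<lambda>F. L1_approximation M F f", OF F])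
  have "AE x in M. \<forall>k. ennreal (P (F k) x) \<le> (SUP j. ennreal (P (G j) x))"
    using L1_approximation_le[OF P F G] by (simp add: AE_all_countable)
  moreover have "AE x in M. \<forall>k. ennreal (P (G k) x) \<le> (SUP j. ennreal (P (F j) x))"
    using L1_approximation_le[OF P G F] by (simp add: AE_all_countable)
  ultimately show ?thesis
    unfolding markov_sup_def G_def[symmetric]
    by eventually_elim (intro antisym SUP_least; auto)
qed

lemma markov_sup_tendsto:
  assumes F: "L1_approximation M F f"
  shows "AE x in M. (\<lambda>k. ennreal (P (F k) x)) \<longlonglongrightarrow> markov_sup M P f x"
  using markov_sup_eq_SUP[OF F] L1_approximation_tendsto_SUP[OF P F]
  by eventually_elim simp

lemma borel_measurable_markov_sup [measurable]:
  assumes "f \<in> borel_measurable M"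
  shows "markov_sup M P f \<in> borel_measurable M"
proof -
  define F where "F = (SOME F. L1_approximation M F f)"
  have "L1_approximation M F f"
    unfolding F_def using L1_approximation_exists[OF M assms] by (rule someI_ex)
  then have [measurable]: "P (F k) \<in> borel_measurable M" for k
    using markov_integrable[OF P] by (auto simp: L1_approximation_def)
  show ?thesis unfolding markov_sup_def F_def[symmetric] by measurable
qed

text \<open>Carries the hypothesis on \<open>u\<close> over to \<open>markov_sup\<close>: both sides
  are almost everywhere the limit of \<open>P (F k)\<close> for the same \<open>F\<close>.\<close>

lemma markov_extension_eq_sup:
  assumes "f \<in> borel_measurable M"
  shows "AE x in M. markov_extension M P f x = markov_sup M P f x"
proof -
  obtain F where F: "L1_approximation M F f" using L1_approximation_exists[OF M assms] by blast
  show ?thesis using markov_extension_eq[OF P F] markov_sup_tendsto[OF F]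
    by eventually_elim (rule LIMSEQ_unique)
qed

text \<open>A nonnegative integrable function is approximated by the constant sequence.\<close>

lemma markov_sup_integrable:
  assumes "integrable M f" "AE x in M. 0 \<le> f x"
  shows "AE x in M. markov_sup M P (\<lambda>y. ennreal (f y)) x = ennreal (P f x)"
  using markov_sup_eq_SUP[OF L1_approximation_const[OF assms]] by simp

lemma markov_sup_mono:
  assumes f: "f \<in> borel_measurable M" and g: "g \<in> borel_measurable M"
    and le: "AE x in M. f x \<le> g x"
  shows "AE x in M. markov_sup M P f x \<le> markov_sup M P g x"
proof -
  obtain F G where F: "L1_approximation M F f" and G: "L1_approximation M G g"
    using L1_approximation_exists[OF M] f g by meson
  note H = L1_approximation_max[OF F G le]
  have int: "integrable M (F k)" "integrable M (G k)" for k
    using F G by (auto simp: L1_approximation_def)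
  have "AE x in M. \<forall>k. P (F k) x \<le> P (\<lambda>x. max (F k x) (G k x)) x"
    unfolding AE_all_countable using int by (auto intro!: markov_mono[OF P])
  then show ?thesis
    using markov_sup_eq_SUP[OF F] markov_sup_eq_SUP[OF H]
    by eventually_elim (auto intro!: SUP_mono ennreal_leI)
qed

lemma markov_sup_cong:
  assumes "f \<in> borel_measurable M" "g \<in> borel_measurable M" "AE x in M. f x = g x"
  shows "AE x in M. markov_sup M P f x = markov_sup M P g x"
proof -
  have "AE x in M. f x \<le> g x" "AE x in M. g x \<le> f x" using assms(3) by auto
  from markov_sup_mono[OF assms(1,2) this(1)] markov_sup_mono[OF assms(2,1) this(2)]
  show ?thesis by eventually_elim simp
qed

lemma markov_sup_add:
  assumes f: "f \<in> borel_measurable M" and g: "g \<in> borel_measurable M"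
  shows "AE x in M. markov_sup M P (\<lambda>y. f y + g y) x = markov_sup M P f x + markov_sup M P g x"
proof -
  obtain F G where F: "L1_approximation M F f" and G: "L1_approximation M G g"
    using L1_approximation_exists[OF M] f g by meson
  have int: "integrable M (F k)" "integrable M (G k)" for k
    using F G by (auto simp: L1_approximation_def)
  have "AE x in M. \<forall>k. P (\<lambda>x. F k x + G k x) x = P (F k) x + P (G k) x"
    unfolding AE_all_countable using int by (auto intro!: markov_add[OF P])
  \<comment> \<open>\<open>ennreal\<close> sends negative reals to 0, so it splits over the sum only
    once both summands are known to be nonnegative.\<close>
  moreover have "AE x in M. \<forall>k. 0 \<le> P (F k) x" "AE x in M. \<forall>k. 0 \<le> P (G k) x"
    unfolding AE_all_countable using F G int
    by (simp_all add: markov_nonneg[OF P] L1_approximation_def)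
  ultimately show ?thesis
    using markov_sup_tendsto[OF L1_approximation_add[OF F G]]
      markov_sup_tendsto[OF F] markov_sup_tendsto[OF G]
  proof eventually_elim
    case (elim x)
    then have "(\<lambda>k. ennreal (P (F k) x) + ennreal (P (G k) x))
        \<longlonglongrightarrow> markov_sup M P f x + markov_sup M P g x"
      by (intro tendsto_add) auto
    then show ?case using elim by (auto intro: LIMSEQ_unique)
  qed
qed

text \<open>The nontrivial half of continuity from below. Each \<open>F k\<close> approximating the
  supremum is the increasing limit of its truncations by \<open>g n\<close>; \<open>P\<close> of
  such a truncation lies below the extension at \<open>g n\<close>, and the suprema over
  \<open>n\<close> and then \<open>k\<close> give the claim.\<close>

lemma markov_sup_SUP_le:
  fixes g :: "nat \<Rightarrow> 'a \<Rightarrow> ennreal"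
  assumes [measurable]: "\<And>n. g n \<in> borel_measurable M" and inc: "AE x in M. incseq (\<lambda>n. g n x)"
  shows "AE x in M. markov_sup M P (\<lambda>y. SUP n. g n y) x \<le> (SUP n. markov_sup M P (g n) x)"
proof -
  have "(\<lambda>y. SUP n. g n y) \<in> borel_measurable M" by measurable
  then obtain F where F: "L1_approximation M F (\<lambda>y. SUP n. g n y)"
    using L1_approximation_exists[OF M] by blast
  have "AE x in M. ennreal (P (F k) x) \<le> (SUP n. markov_sup M P (g n) x)" for k
  proof -
    have int: "integrable M (F k)" and nn: "AE x in M. 0 \<le> F k x"
      using F by (auto simp: L1_approximation_def)
    then have [measurable]: "F k \<in> borel_measurable M" by auto
    define H where "H n x = enn2real (min (ennreal (F k x)) (g n x))" for n x
    have "AE x in M. ennreal (F k x) \<le> (SUP n. g n x)"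
      using L1_approximation_SUP[OF F]
    proof eventually_elim
      case (elim x)
      show ?case unfolding elim by (rule SUP_upper) simp
    qed
    then have H: "L1_approximation M H (\<lambda>x. ennreal (F k x))"
      unfolding H_def using int nn inc by (intro L1_approximation_min) auto
    have [measurable]: "H n \<in> borel_measurable M" for n unfolding H_def by measurable
    have "AE x in M. ennreal (P (H n) x) \<le> markov_sup M P (g n) x" for n
    proof -
      have "AE x in M. markov_sup M P (\<lambda>y. ennreal (H n y)) x \<le> markov_sup M P (g n) x"
        by (intro markov_sup_mono AE_I2) (auto simp: H_def min_less_iff_disj)
      moreover have "AE x in M. markov_sup M P (\<lambda>y. ennreal (H n y)) x = ennreal (P (H n) x)"
        using H by (intro markov_sup_integrable) (auto simp: L1_approximation_def)
      ultimately show ?thesis by eventually_elim simp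
    qed
    then have "AE x in M. \<forall>n. ennreal (P (H n) x) \<le> markov_sup M P (g n) x"
      by (simp add: AE_all_countable)
    then show ?thesis using markov_sup_eq_SUP[OF H] markov_sup_integrable[OF int nn]
    proof eventually_elim
      case (elim x)
      then show ?case by (metis (mono_tags, lifting) SUP_mono)
    qed
  qed
  then have "AE x in M. \<forall>k. ennreal (P (F k) x) \<le> (SUP n. markov_sup M P (g n) x)"
    by (simp add: AE_all_countable)
  then show ?thesis using markov_sup_eq_SUP[OF F]
    by eventually_elim (auto intro: SUP_least)
qed

section \<open>Iterates of the extension\<close>

lemma borel_measurable_markov_sup_funpow [measurable]:
  "f \<in> borel_measurable M \<Longrightarrow> (markov_sup M P ^^ n) f \<in> borel_measurable M"
  by (induction n) auto

text \<open>The way back from the extension to \<open>P ^^ n\<close> on L1; positivity of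
  \<open>P ^^ n\<close> allows the one-step agreement to be applied again.\<close>

lemma markov_sup_funpow_integrable:
  assumes f: "integrable M f" "AE x in M. 0 \<le> f x"
  shows "AE x in M. (markov_sup M P ^^ n) (\<lambda>y. ennreal (f y)) x = ennreal ((P ^^ n) f x)"
proof (induction n)
  case (Suc n)
  note Pn = markov_operator_funpow[OF P, of n]
  have int: "integrable M ((P ^^ n) f)" using f by (intro markov_integrable[OF Pn])
  have [measurable]: "f \<in> borel_measurable M" "(P ^^ n) f \<in> borel_measurable M"
    using f int by auto
  have "AE x in M. markov_sup M P ((markov_sup M P ^^ n) (\<lambda>y. ennreal (f y))) x =
      markov_sup M P (\<lambda>y. ennreal ((P ^^ n) f y)) x"
    by (intro markov_sup_cong Suc.IH) measurable
  moreover have "AE x in M. markov_sup M P (\<lambda>y. ennreal ((P ^^ n) f y)) x = ennreal (P ((P ^^ n) f) x)"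
    using f by (intro markov_sup_integrable int markov_nonneg[OF Pn])
  ultimately show ?case by eventually_elim simp
qed simp

lemma markov_sup_funpow_mono:
  assumes "f \<in> borel_measurable M" "g \<in> borel_measurable M" "AE x in M. f x \<le> g x"
  shows "AE x in M. (markov_sup M P ^^ n) f x \<le> (markov_sup M P ^^ n) g x"
  using assms by (induction n) (simp_all add: markov_sup_mono)

lemma markov_sup_funpow_add:
  assumes [measurable]: "f \<in> borel_measurable M" "g \<in> borel_measurable M"
  shows "AE x in M. (markov_sup M P ^^ n) (\<lambda>y. f y + g y) x =
    (markov_sup M P ^^ n) f x + (markov_sup M P ^^ n) g x"
proof (induction n)
  case (Suc n)
  let ?E = "markov_sup M P"
  have "AE x in M. ?E ((?E ^^ n) (\<lambda>y. f y + g y)) x = ?E (\<lambda>y. (?E ^^ n) f y + (?E ^^ n) g y) x"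
    by (intro markov_sup_cong Suc.IH) measurable
  moreover have "AE x in M. ?E (\<lambda>y. (?E ^^ n) f y + (?E ^^ n) g y) x =
      ?E ((?E ^^ n) f) x + ?E ((?E ^^ n) g) x"
    by (intro markov_sup_add) measurable
  ultimately show ?case by eventually_elim simp
qed simp

section \<open>Subinvariant functions\<close>

lemma markov_sup_funpow_decseq:
  assumes [measurable]: "u \<in> borel_measurable M" and sub: "AE x in M. markov_sup M P u x \<le> u x"
  shows "AE x in M. decseq (\<lambda>n. (markov_sup M P ^^ n) u x)"
proof -
  have "AE x in M. (markov_sup M P ^^ n) (markov_sup M P u) x \<le> (markov_sup M P ^^ n) u x" for n
    using sub by (intro markov_sup_funpow_mono) auto
  \<comment> \<open>\<open>funpow_Suc_right\<close> moves the extra application innermost, where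
    subinvariance gives the comparison.\<close>
  then have "AE x in M. \<forall>n. (markov_sup M P ^^ Suc n) u x \<le> (markov_sup M P ^^ n) u x"
    unfolding AE_all_countable funpow_Suc_right by simp
  then show ?thesis by eventually_elim (simp add: decseq_Suc_iff)
qed

text \<open>Continuity is at hand only along increasing sequences, while the iterates decrease, so
  the argument runs on the complements \<open>u - U n\<close>. With E the extension, it gives E(u -
  v) + v \<le> E u = E(u - v) + E v, and the finite term E(u - v) cancels.\<close>

lemma INF_funpow_le_markov_sup:
  assumes [measurable]: "u \<in> borel_measurable M" and sub: "AE x in M. markov_sup M P u x \<le> u x"
    and fin: "AE x in M. u x < \<infinity>"
  defines "v \<equiv> \<lambda>x. INF n. (markov_sup M P ^^ n) u x"
  shows "AE x in M. v x \<le> markov_sup M P v x"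
proof -
  define U where "U n = (markov_sup M P ^^ n) u" for n
  have U0: "U 0 = u" and USuc: "U (Suc n) = markov_sup M P (U n)" for n by (auto simp: U_def)
  have [measurable]: "U n \<in> borel_measurable M" for n unfolding U_def by measurable
  have v: "v = (\<lambda>x. INF n. U n x)" by (simp add: v_def U_def)
  have [measurable]: "v \<in> borel_measurable M" unfolding v by measurable
  have dec: "AE x in M. decseq (\<lambda>n. U n x)"
    unfolding U_def by (rule markov_sup_funpow_decseq[OF _ sub]) simp
  \<comment> \<open>Subtraction turns the infimum into a supremum only where \<open>u x\<close> is
    finite.\<close>
  have SUP: "AE x in M. u x - v x = (SUP n. u x - U n x)"
  proof (rule AE_mp[OF fin], intro AE_I2 impI)
    fix x assume "u x < \<infinity>"
    then show "u x - v x = (SUP n. u x - U n x)"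
      unfolding v by (subst ennreal_INF_const_minus[symmetric]) auto
  qed
  have inc: "AE x in M. incseq (\<lambda>n. u x - U n x)"
    using dec by eventually_elim (auto simp: incseq_def decseq_def intro!: ennreal_minus_mono)
  \<comment> \<open>Additivity in place of a subtraction rule: subtraction in \<open>ennreal\<close>
    is truncated, and (u - g) + g recovers \<open>u\<close> only where g \<le> u.\<close>
  have split: "AE x in M. markov_sup M P u x =
      markov_sup M P (\<lambda>y. u y - g y) x + markov_sup M P g x"
    if [measurable]: "g \<in> borel_measurable M" and le: "AE x in M. g x \<le> u x" for g
  proof -
    have "AE x in M. u x = u x - g x + g x"
      using le by eventually_elim (simp add: diff_add_cancel_ennreal)
    then have "AE x in M. markov_sup M P u x = markov_sup M P (\<lambda>y. u y - g y + g y) x"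
      by (intro markov_sup_cong) measurable
    moreover have "AE x in M. markov_sup M P (\<lambda>y. u y - g y + g y) x =
        markov_sup M P (\<lambda>y. u y - g y) x + markov_sup M P g x"
      by (intro markov_sup_add) measurable
    ultimately show ?thesis by eventually_elim simp
  qed
  have "AE x in M. v x \<le> u x"
    unfolding v U0[symmetric] by (intro AE_I2 INF_lower) simp
  from split[OF _ this]
  have split_v: "AE x in M. markov_sup M P u x =
      markov_sup M P (\<lambda>y. u y - v y) x + markov_sup M P v x"
    by simp
  have "AE x in M. U n x \<le> u x" for n
    using dec by eventually_elim (auto simp: decseq_def U0[symmetric])
  then have split_U: "AE x in M. \<forall>n. markov_sup M P u x =
      markov_sup M P (\<lambda>y. u y - U n y) x + U (Suc n) x"
    unfolding AE_all_countable USuc by (intro allI split) auto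
  have "AE x in M. markov_sup M P (\<lambda>y. u y - v y) x = markov_sup M P (\<lambda>y. SUP n. u y - U n y) x"
    by (intro markov_sup_cong SUP) measurable
  moreover have "AE x in M. markov_sup M P (\<lambda>y. SUP n. u y - U n y) x
      \<le> (SUP n. markov_sup M P (\<lambda>y. u y - U n y) x)"
    by (intro markov_sup_SUP_le inc) measurable
  ultimately show ?thesis using split_v split_U sub fin
  proof eventually_elim
    case (elim x)
    define a where "a = markov_sup M P (\<lambda>y. u y - v y) x"
    have fin: "markov_sup M P u x < top" using le_less_trans[OF elim(5,6)] by simp
    have le: "v x \<le> U n x" for n unfolding v by (rule INF_lower) simp
    have v_le: "v x \<le> markov_sup M P u x" using le[of 1] by (simp add: U_def)
    \<comment> \<open>One application of the extension shifts the index: what complements this term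
      in E u is \<open>U (Suc n)\<close>, which again lies above \<open>v\<close>.\<close>
    have "markov_sup M P (\<lambda>y. u y - U n y) x \<le> markov_sup M P u x - v x" for n
    proof -
      have "markov_sup M P (\<lambda>y. u y - U n y) x + v x \<le> markov_sup M P u x"
        unfolding elim(4)[rule_format, of n] by (intro add_left_mono le)
      then show ?thesis by (simp add: ennreal_le_minus_iff)
    qed
    then have "a \<le> markov_sup M P u x - v x"
      unfolding a_def elim(1) by (rule order_trans[OF elim(2) SUP_least])
    then have "a + v x \<le> markov_sup M P u x - v x + v x" by (rule add_right_mono)
    also have "\<dots> = markov_sup M P u x" using v_le by (rule diff_add_cancel_ennreal)
    also have "\<dots> = a + markov_sup M P v x" using elim(3) unfolding a_def .
    finally have "a = top \<or> v x \<le> markov_sup M P v x"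
      by (simp add: ennreal_add_left_cancel_le)
    moreover have "a \<noteq> top" using elim(3) fin by (auto simp: a_def)
    ultimately show ?case by blast
  qed
qed

text \<open>Iterating v \<le> E v and using additivity on w + v = u gives \<open>E ^^ n\<close> w +
  v \<le> \<open>E ^^ n\<close> u, with E the extension. Both the bound by \<open>u\<close> and the
  decay to 0 follow from this.\<close>

lemma exists_vanishing_function:
  assumes u[measurable]: "u \<in> borel_measurable M" and sub: "AE x in M. markov_sup M P u x < u x"
    and fin: "AE x in M. u x < \<infinity>"
  shows "\<exists>w\<in>borel_measurable M. (AE x in M. 0 < w x \<and> w x < \<infinity>) \<and>
    (AE x in M. \<forall>n. (markov_sup M P ^^ n) w x \<le> u x) \<and>
    (AE x in M. (\<lambda>n. (markov_sup M P ^^ n) w x) \<longlonglongrightarrow> 0)"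
proof -
  define U where "U n = (markov_sup M P ^^ n) u" for n
  define v where "v x = (INF n. U n x)" for x
  define w where "w x = u x - v x" for x
  have [measurable]: "U n \<in> borel_measurable M" for n unfolding U_def by measurable
  have [measurable]: "v \<in> borel_measurable M" unfolding v_def by measurable
  have [measurable]: "w \<in> borel_measurable M" unfolding w_def by measurable
  have le: "AE x in M. markov_sup M P u x \<le> u x" using sub by eventually_elim simp
  have dec: "AE x in M. decseq (\<lambda>n. U n x)"
    unfolding U_def by (rule markov_sup_funpow_decseq[OF u le])
  have v_le: "AE x in M. v x \<le> markov_sup M P v x"
    using INF_funpow_le_markov_sup[OF u le fin] unfolding v_def U_def .
  have v_funpow: "AE x in M. v x \<le> (markov_sup M P ^^ n) v x" for n
  proof (induction n)
    case (Suc n)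
    then have "AE x in M. markov_sup M P v x \<le> markov_sup M P ((markov_sup M P ^^ n) v) x"
      by (intro markov_sup_mono) auto
    with v_le show ?case by eventually_elim auto
  qed simp
  have vU: "v x \<le> U n x" for n x unfolding v_def by (rule INF_lower) simp
  have wv: "w x + v x = u x" for x
    using vU[of x 0] by (simp add: w_def U_def diff_add_cancel_ennreal)
  have "AE x in M. (markov_sup M P ^^ n) w x + v x \<le> U n x" for n
  proof -
    have "AE x in M. U n x = (markov_sup M P ^^ n) w x + (markov_sup M P ^^ n) v x"
      using markov_sup_funpow_add[of w v n] by (simp add: wv U_def)
    then show ?thesis using v_funpow[of n] by eventually_elim (simp add: add_left_mono)
  qed
  then have "AE x in M. \<forall>n. (markov_sup M P ^^ n) w x + v x \<le> U n x"
    by (simp add: AE_all_countable)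
  then have "AE x in M. (0 < w x \<and> w x < \<infinity>) \<and> (\<forall>n. (markov_sup M P ^^ n) w x \<le> u x) \<and>
      (\<lambda>n. (markov_sup M P ^^ n) w x) \<longlonglongrightarrow> 0"
    using dec sub fin
  proof eventually_elim
    case (elim x)
    \<comment> \<open>Strictness enters here: index 1 puts \<open>v\<close> below the image of
      \<open>u\<close>, which is strictly below \<open>u\<close>.\<close>
    have "v x < u x" using vU[of x 1] elim(3) by (simp add: U_def)
    then have "0 < w x" by (simp add: w_def diff_gr0_ennreal)
    moreover have "w x < \<infinity>" using elim(4) unfolding w_def
      by (rule le_less_trans[OF diff_le_self_ennreal])
    moreover have "(markov_sup M P ^^ n) w x \<le> u x" for n
    proof -
      have "(markov_sup M P ^^ n) w x \<le> (markov_sup M P ^^ n) w x + v x" by simp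
      also have "\<dots> \<le> U n x" using elim by blast
      also have "\<dots> \<le> U 0 x" using elim(2) by (simp add: decseq_def)
      finally show ?thesis by (simp add: U_def)
    qed
    moreover have "(\<lambda>n. (markov_sup M P ^^ n) w x) \<longlonglongrightarrow> 0"
    proof (rule tendsto_sandwich[OF _ _ tendsto_const])
      \<comment> \<open>In \<open>ennreal\<close>, \<open>top - top\<close> is \<open>top\<close>,
        so the limit v x - v x is 0 only for finite \<open>v x\<close>.\<close>
      have v_fin: "v x \<noteq> top" using \<open>v x < u x\<close> by auto
      have "(\<lambda>n. U n x - v x) \<longlonglongrightarrow> v x - v x"
        unfolding v_def using elim(2) v_fin
        by (intro tendsto_diff_ennreal LIMSEQ_INF tendsto_const) (auto simp: v_def)
      then show "(\<lambda>n. U n x - v x) \<longlonglongrightarrow> 0" using v_fin by (simp add: less_top)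
      show "\<forall>\<^sub>F n in sequentially. (markov_sup M P ^^ n) w x \<le> U n x - v x"
      proof (intro always_eventually allI)
        fix n
        have "(markov_sup M P ^^ n) w x + v x \<le> U n x" using elim by blast
        then show "(markov_sup M P ^^ n) w x \<le> U n x - v x"
          by (simp add: ennreal_le_minus_iff)
      qed
    qed simp
    ultimately show ?case by blast
  qed
  then show ?thesis by (intro bexI[of _ w]) auto
qed

section \<open>Sweeping\<close>

text \<open>The functions \<open>k * min (f / k) w\<close> increase to \<open>f\<close> because \<open>w > 0\<close>.\<close>

lemma integral_funpow_tendsto_0_dense:
  fixes w :: "'a \<Rightarrow> real"
  assumes [measurable]: "A \<in> sets M" "w \<in> borel_measurable M" and w: "AE x in M. 0 < w x"
    and vanish: "\<And>h. integrable M h \<Longrightarrow> AE x in M. 0 \<le> h x \<and> h x \<le> w x \<Longrightarrow>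
      (\<lambda>n. LINT x:A|M. (P ^^ n) h x) \<longlonglongrightarrow> 0"
    and f: "integrable M f"
  shows "(\<lambda>n. LINT x:A|M. (P ^^ n) f x) \<longlonglongrightarrow> 0"
proof -
  note Pn = markov_operator_funpow[OF P]
  have set_int: "integrable M (\<lambda>x. indicator A x * (P ^^ n) g x)" if "integrable M g" for g n
    using integrable_real_mult_indicator[OF assms(1) markov_integrable[OF Pn that]]
    by (simp add: mult.commute)
  define g where "g x = \<bar>f x\<bar>" for x
  have g: "integrable M g" "g x \<ge> 0" for x using f by (auto simp: g_def[abs_def])
  have [measurable]: "g \<in> borel_measurable M" using g by auto
  \<comment> \<open>\<open>Suc k\<close> avoids division by zero, and |w| keeps \<open>h k\<close>
    nonnegative everywhere while agreeing with \<open>w\<close> almost everywhere.\<close>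
  define h where "h k x = min (g x / real (Suc k)) \<bar>w x\<bar>" for k x
  have h: "integrable M (h k)" for k
    by (rule Bochner_Integration.integrable_bound[where f = "\<lambda>x. g x / real (Suc k)"])
      (use g in \<open>auto simp: h_def[abs_def] intro!: AE_I2\<close>)
  have hn: "(\<lambda>n. LINT x:A|M. (P ^^ n) (h k) x) \<longlonglongrightarrow> 0" for k
    using w by (intro vanish h, eventually_elim) (auto simp: h_def g)
  have diff: "integrable M (\<lambda>x. g x - real (Suc k) * h k x)" for k
    using g h by (intro Bochner_Integration.integrable_diff integrable_mult_right)
  \<comment> \<open>At a point with w x > 0 the error is exactly 0 once k \<ge> g x / w x, and it is
    dominated by \<open>g\<close> throughout.\<close>
  have "(\<lambda>k. LINT x|M. \<bar>g x - real (Suc k) * h k x\<bar>) \<longlonglongrightarrow> (LINT x|M. (0::real))"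
  proof (rule integral_dominated_convergence)
    show "AE x in M. (\<lambda>k. \<bar>g x - real (Suc k) * h k x\<bar>) \<longlonglongrightarrow> 0"
      using w
    proof eventually_elim
      case (elim x)
      obtain N where N: "g x / w x < real N" using reals_Archimedean2 by blast
      have "\<forall>\<^sub>F k in sequentially. \<bar>g x - real (Suc k) * h k x\<bar> = 0"
        using eventually_ge_at_top[of N]
      proof eventually_elim
        case (elim k)
        then have "g x / w x \<le> real (Suc k)" using N by linarith
        then have "g x / real (Suc k) \<le> w x"
          using \<open>0 < w x\<close> by (simp add: field_simps)
        then show ?case using \<open>0 < w x\<close> by (simp add: h_def min_absorb1)
      qed
      then show ?case by (rule tendsto_eventually)
    qed
    show "AE x in M. norm \<bar>g x - real (Suc k) * h k x\<bar> \<le> g x" for k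
    proof (rule AE_I2)
      fix x
      have "real (Suc k) * h k x \<le> real (Suc k) * (g x / real (Suc k))"
        unfolding h_def by (intro mult_left_mono) auto
      moreover have "0 \<le> real (Suc k) * h k x" using g(2)[of x] by (auto simp: h_def)
      ultimately show "norm \<bar>g x - real (Suc k) * h k x\<bar> \<le> g x" by simp
    qed
  qed (use g(1) diff in \<open>auto simp: h_def[abs_def]\<close>)
  then have small: "(\<lambda>k. LINT x|M. \<bar>g x - real (Suc k) * h k x\<bar>) \<longlonglongrightarrow> 0" by simp
  \<comment> \<open>With g = d + (k+1) h_k, contraction bounds the contribution of d by its norm,
    independently of \<open>n\<close>; the rest vanishes as \<open>n\<close> grows for fixed
    \<open>k\<close>.\<close>
  have bound: "\<bar>LINT x:A|M. (P ^^ n) f x\<bar> \<le>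
      (LINT x|M. \<bar>g x - real (Suc k) * h k x\<bar>) + real (Suc k) * (LINT x:A|M. (P ^^ n) (h k) x)" for n k
  proof -
    let ?d = "\<lambda>x. g x - real (Suc k) * h k x"
    have d: "integrable M (\<lambda>x. \<bar>(P ^^ n) ?d x\<bar>)"
      using markov_integrable[OF Pn diff] by (rule integrable_abs)
    have kh: "integrable M (\<lambda>x. real (Suc k) * (indicator A x * (P ^^ n) (h k) x))"
      using h by (intro integrable_mult_right set_int)
    have "AE x in M. (P ^^ n) g x \<le> \<bar>(P ^^ n) ?d x\<bar> + real (Suc k) * (P ^^ n) (h k) x"
      using markov_diff[OF Pn g(1) integrable_mult_right[OF h], of n "real (Suc k)" k]
        markov_mult[OF Pn h, of n "real (Suc k)" k]
      by eventually_elim auto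
    with markov_abs_le[OF Pn f, of n]
    have le: "AE x in M. \<bar>indicator A x * (P ^^ n) f x\<bar> \<le>
        \<bar>(P ^^ n) ?d x\<bar> + real (Suc k) * (indicator A x * (P ^^ n) (h k) x)"
      unfolding g_def[symmetric] by eventually_elim (auto simp: indicator_def)
    have "\<bar>LINT x|M. indicator A x * (P ^^ n) f x\<bar> \<le> (LINT x|M. \<bar>indicator A x * (P ^^ n) f x\<bar>)"
      by (rule integral_abs_bound)
    also have "\<dots> \<le> (LINT x|M. \<bar>(P ^^ n) ?d x\<bar> + real (Suc k) * (indicator A x * (P ^^ n) (h k) x))"
      using le by (intro integral_mono_AE integrable_abs[OF set_int[OF f]]
        Bochner_Integration.integrable_add[OF d kh])
    also have "\<dots> = (LINT x|M. \<bar>(P ^^ n) ?d x\<bar>) +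
        real (Suc k) * (LINT x|M. indicator A x * (P ^^ n) (h k) x)"
      using d kh by (subst Bochner_Integration.integral_add) auto
    also have "\<dots> \<le> (LINT x|M. \<bar>?d x\<bar>) + real (Suc k) * (LINT x|M. indicator A x * (P ^^ n) (h k) x)"
      by (intro add_right_mono markov_contraction[OF Pn] diff)
    finally show ?thesis by (simp add: set_lebesgue_integral_def)
  qed
  show ?thesis
  proof (rule LIMSEQ_I)
    fix e :: real assume e: "0 < e"
    \<comment> \<open>\<open>k\<close> can be fixed before \<open>N\<close>, since the first term of
      \<open>bound\<close> does not involve \<open>n\<close>.\<close>
    obtain k where k: "\<bar>LINT x|M. \<bar>g x - real (Suc k) * h k x\<bar>\<bar> < e / 2"
      using LIMSEQ_D[OF small half_gt_zero[OF e]] by auto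
    have "(\<lambda>n. real (Suc k) * (LINT x:A|M. (P ^^ n) (h k) x)) \<longlonglongrightarrow> real (Suc k) * 0"
      by (intro tendsto_mult tendsto_const hn)
    then obtain N where N: "\<And>n. n \<ge> N \<Longrightarrow> \<bar>real (Suc k) * (LINT x:A|M. (P ^^ n) (h k) x)\<bar> < e / 2"
      using LIMSEQ_D[OF _ half_gt_zero[OF e]] by fastforce
    have "norm ((LINT x:A|M. (P ^^ n) f x) - 0) < e" if "n \<ge> N" for n
      using bound[of n k] k N[OF that] by simp
    then show "\<exists>no. \<forall>n\<ge>no. norm ((LINT x:A|M. (P ^^ n) f x) - 0) < e" by blast
  qed
qed

text \<open>Since h \<le> w, the integrals of \<open>P ^^ n\<close> h over \<open>A\<close> lie
  below those of the iterates of \<open>w\<close>, which vanish by dominated convergence with the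
  bound \<open>u\<close> on \<open>A\<close>. \<open>w\<close> itself need not be integrable, hence
  the detour through nonnegative integrals.\<close>

lemma integral_funpow_tendsto_0_dominated:
  fixes u w :: "'a \<Rightarrow> ennreal"
  assumes [measurable]: "A \<in> sets M" "u \<in> borel_measurable M" "w \<in> borel_measurable M"
    and fin: "(\<integral>\<^sup>+x\<in>A. u x \<partial>M) < \<infinity>"
    and le: "AE x in M. \<forall>n. (markov_sup M P ^^ n) w x \<le> u x"
    and lim: "AE x in M. (\<lambda>n. (markov_sup M P ^^ n) w x) \<longlonglongrightarrow> 0"
    and h: "integrable M h" "AE x in M. 0 \<le> h x" "AE x in M. ennreal (h x) \<le> w x"
  shows "(\<lambda>n. LINT x:A|M. (P ^^ n) h x) \<longlonglongrightarrow> 0"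
proof -
  note Pn = markov_operator_funpow[OF P]
  have [measurable]: "h \<in> borel_measurable M" "(P ^^ n) h \<in> borel_measurable M" for n
    using h markov_integrable[OF Pn] by auto
  have nn: "AE x in M. 0 \<le> (P ^^ n) h x" for n using h by (intro markov_nonneg[OF Pn])
  have "(\<lambda>n. \<integral>\<^sup>+x\<in>A. (markov_sup M P ^^ n) w x \<partial>M) \<longlonglongrightarrow> (\<integral>\<^sup>+x. 0 \<partial>M)"
  proof (rule nn_integral_dominated_convergence[where w = "\<lambda>x. u x * indicator A x"])
    show "AE x in M. (markov_sup M P ^^ n) w x * indicator A x \<le> u x * indicator A x" for n
      using le by eventually_elim (auto intro: mult_right_mono)
    show "AE x in M. (\<lambda>n. (markov_sup M P ^^ n) w x * indicator A x) \<longlonglongrightarrow> 0"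
      using lim by eventually_elim (auto simp: indicator_def)
  qed (use fin in auto)
  then have lim_w: "(\<lambda>n. \<integral>\<^sup>+x\<in>A. (markov_sup M P ^^ n) w x \<partial>M) \<longlonglongrightarrow> 0" by simp
  have eq: "ennreal (LINT x:A|M. (P ^^ n) h x) = (\<integral>\<^sup>+x\<in>A. ennreal ((P ^^ n) h x) \<partial>M)" for n
  proof -
    have "integrable M (\<lambda>x. indicator A x * (P ^^ n) h x)"
      using integrable_real_mult_indicator[OF assms(1) markov_integrable[OF Pn h(1)]]
      by (simp add: mult.commute)
    then have "(\<integral>\<^sup>+x. ennreal (indicator A x * (P ^^ n) h x) \<partial>M) =
        ennreal (LINT x|M. indicator A x * (P ^^ n) h x)"
      by (intro nn_integral_eq_integral eventually_mono[OF nn[of n]]) (auto simp: indicator_def)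
    moreover have "(\<integral>\<^sup>+x. ennreal (indicator A x * (P ^^ n) h x) \<partial>M) =
        (\<integral>\<^sup>+x\<in>A. ennreal ((P ^^ n) h x) \<partial>M)"
      by (intro nn_integral_cong) (auto simp: indicator_def)
    ultimately show ?thesis by (simp add: set_lebesgue_integral_def)
  qed
  have "(\<integral>\<^sup>+x\<in>A. ennreal ((P ^^ n) h x) \<partial>M) \<le> (\<integral>\<^sup>+x\<in>A. (markov_sup M P ^^ n) w x \<partial>M)" for n
  proof (rule nn_integral_mono_AE)
    have "AE x in M. (markov_sup M P ^^ n) (\<lambda>y. ennreal (h y)) x \<le> (markov_sup M P ^^ n) w x"
      using h by (intro markov_sup_funpow_mono) auto
    with markov_sup_funpow_integrable[OF h(1,2), of n]
    show "AE x in M. ennreal ((P ^^ n) h x) * indicator A x \<le>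
        (markov_sup M P ^^ n) w x * indicator A x"
      by eventually_elim (auto intro: mult_right_mono)
  qed
  then have "(\<lambda>n. ennreal (LINT x:A|M. (P ^^ n) h x)) \<longlonglongrightarrow> 0"
    unfolding eq by (intro tendsto_sandwich[OF _ _ tendsto_const lim_w]) auto
  moreover have "0 \<le> (LINT x:A|M. (P ^^ n) h x)" for n
    unfolding set_lebesgue_integral_def
    by (intro integral_nonneg_AE eventually_mono[OF nn[of n]]) (auto simp: indicator_def)
  ultimately show ?thesis
    by (subst tendsto_ennreal_iff[symmetric]) auto
qed

end

theorem theorem2:
  fixes M :: "'a measure"
    and P :: "('a \<Rightarrow> real) \<Rightarrow> 'a \<Rightarrow> real"
    and \<A> :: "'a set set"
  assumes "sigma_finite_measure M"
    and "markov_operator M P"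
    and "admissible_family M \<A>"
    and "\<exists>u :: 'a \<Rightarrow> real. u \<in> borel_measurable M \<and> (AE x in M. 0 < u x) \<and>
           properly_subinvariant M P (\<lambda>x. ennreal (u x)) \<and>
           locally_integrable M \<A> (\<lambda>x. ennreal (u x))"
  shows "sweeping M \<A> P"
proof -
  note M = assms(1) and P = assms(2)
  obtain u :: "'a \<Rightarrow> real" where [measurable]: "u \<in> borel_measurable M"
    and sub: "AE x in M. markov_extension M P (\<lambda>x. ennreal (u x)) x < ennreal (u x)"
    and loc: "\<And>A. A \<in> \<A> \<Longrightarrow> (\<integral>\<^sup>+x\<in>A. ennreal (u x) \<partial>M) < \<infinity>"
    using assms(4) unfolding properly_subinvariant_def locally_integrable_def by blast
  have "(\<lambda>x. ennreal (u x)) \<in> borel_measurable M" by measurable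
  from sub markov_extension_eq_sup[OF M P this]
  have "AE x in M. markov_sup M P (\<lambda>x. ennreal (u x)) x < ennreal (u x)"
    by eventually_elim simp
  then obtain w where [measurable]: "w \<in> borel_measurable M"
    and w: "AE x in M. 0 < w x \<and> w x < \<infinity>"
      "AE x in M. \<forall>n. (markov_sup M P ^^ n) w x \<le> ennreal (u x)"
      "AE x in M. (\<lambda>n. (markov_sup M P ^^ n) w x) \<longlonglongrightarrow> 0"
    using exists_vanishing_function[OF M P, of "\<lambda>x. ennreal (u x)"] by auto
  show ?thesis unfolding sweeping_def
  proof (intro ballI allI impI)
    fix A and f :: "'a \<Rightarrow> real" assume A: "A \<in> \<A>" and f: "integrable M f"
    have [measurable]: "A \<in> sets M" using A assms(3) by (auto simp: admissible_family_def)
    show "(\<lambda>n. LINT x:A|M. (P ^^ n) f x) \<longlonglongrightarrow> 0"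
    \<comment> \<open>\<open>w\<close> is finite almost everywhere, so its real version stays
      positive; \<open>enn2real\<close> would send \<open>top\<close> to 0.\<close>
    proof (rule integral_funpow_tendsto_0_dense[OF M P _ _ _ _ f, where w = "\<lambda>x. enn2real (w x)"])
      show "AE x in M. 0 < enn2real (w x)"
        using w(1) by eventually_elim (auto simp: enn2real_positive_iff)
      fix h assume h: "integrable M h" "AE x in M. 0 \<le> h x \<and> h x \<le> enn2real (w x)"
      have "AE x in M. ennreal (h x) \<le> w x"
        using h(2) w(1)
      proof eventually_elim
        case (elim x)
        then have "ennreal (h x) \<le> ennreal (enn2real (w x))" by (intro ennreal_leI) simp
        also have "\<dots> = w x" using elim by simp
        finally show ?case .
      qed
      then show "(\<lambda>n. LINT x:A|M. (P ^^ n) h x) \<longlonglongrightarrow> 0"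
        using h w loc[OF A]
        by (intro integral_funpow_tendsto_0_dominated[OF M P, where u = "\<lambda>x. ennreal (u x)" and w = w])
          auto
    qed auto
  qed
qed

end
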